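(* Let $p$ be a prime number. For a $D$-dimensional $p$-state linear cellular automaton $((\mathbb Z/p\mathbb Z)^{\mathbb Z^D},T)$, $$S_T(p,a)\cong S_T(p,\hat a)$$ for any $a,\hat a\in(\mathbb Z/p\mathbb Z)\setminus\{0\}$.
   Context: The dimension $D$ is any finite positive integer. For an integer $n\ge 2$, $\mathbb Z/n\mathbb Z=\{0,1,\dots,n-1\}$ is the additive group of residue classes of integers modulo $n$. Linear cellular automaton: let $m$ be a finite positive integer, $c_j\in\mathbb Z$ coefficients and $\boldsymbol v_j\in\mathbb Z^D$ vectors for $1\le j\le m$. The transition rule $T$ of a $D$-dimensional $n$-state linear cellular automaton $((\mathbb Z/n\mathbb Z)^{\mathbb Z^D},T)$ is given by $$(Tu)_{\boldsymbol i}=\sum_{j=1}^m c_j\,u_{\boldsymbol i+\boldsymbol v_j}\quad(\text{computed in }\mathbb Z/n\mathbb Z)$$ for $u=\{u_{\boldsymbol i}\}_{\boldsymbol i\in\mathbb Z^D}\in(\mathbb Z/n\mathbb Z)^{\mathbb Z^D}$. Automata with different numbers of states have the same transition rule $T$ when they are given by the same $m$, $c_j$, $\boldsymbol v_j$. $T^t$ is the $t$-fold composition of $T$, with $T^0u=u$. Single site seed: for $a\in(\mathbb Z/n\mathbb Z)\setminus\{0\}$, $u_{\langle a\rangle}\in(\mathbb Z/n\mathbb Z)^{\mathbb Z^D}$ is the configuration with $(u_{\langle a\rangle})_{\boldsymbol 0}=a$ and $(u_{\langle a\rangle})_{\boldsymbol i}=0$ for $\boldsymbol i\ne\boldsymbol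 0$. The spatio-temporal pattern of the $n$-state automaton from the single site seed with $a$ is $\{T^tu_{\langle a\rangle}\}_{t=0}^\infty$. Isomorphic patterns: let $\Delta_T(n,a)$ be the subset of $\mathbb Z/n\mathbb Z$ consisting of those $b$ for which there exists $(\boldsymbol i,t)\in\mathbb Z^D\times\mathbb Z_{\ge0}$ with $(T^tu_{\langle a\rangle})_{\boldsymbol i}=b$. For $n,\hat n\ge2$, a $D$-dimensional $n$-state and a $D$-dimensional $\hat n$-state linear cellular automaton with the same transition rule $T$, and seeds $a\in(\mathbb Z/n\mathbb Z)\setminus\{0\}$, $\hat a\in(\mathbb Z/\hat n\mathbb Z)\setminus\{0\}$: if there exists an isomorphism $f:\Delta_T(n,a)\to\Delta_T(\hat n,\hat a)$ such that $f\big((T^tu_{\langle a\rangle})_{\boldsymbol i}\big)=(T^tu_{\langle\hat a\rangle})_{\boldsymbol i}$ for any site $\boldsymbol i\in\mathbb Z^D$ and any time step $t\in\mathbb Z_{\ge0}$, then the patterns $\{T^tu_{\langle a\rangle}\}_{t=0}^\infty$ and $\{T^tu_{\langle\hat a\rangle}\}_{t=0}^\infty$ are called isomorphic, and this relationship is denoted $S_T(n,a)\cong S_T(\hat n,\hat a)$. (The definition uses the word "isomorphism" for the map $f$ between these subsets without further specification.) *)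

theory Defs
  imports "HOL-Analysis.Finite_Cartesian_Product" "HOL-Computational_Algebra.Primes"
begin

text \<open>
  The group \<open>\<int>/n\<int>\<close> is represented by the integers \<open>0, \<dots>, n - 1\<close> with
  arithmetic modulo \<open>n\<close>, and the lattice \<open>\<int>\<^sup>D\<close> by the type \<open>int ^ 'd\<close> with \<open>D = CARD('d)\<close>.
\<close>

definition residues_mod :: "int \<Rightarrow> int set" where
  "residues_mod n = {0..<n}"

text \<open>
  A transition rule is given by the number \<open>m\<close> of summands, the coefficients \<open>c j\<close> and the
  vectors \<open>v j\<close> for \<open>1 \<le> j \<le> m\<close>; values outside this range are irrelevant. The same
  \<open>m\<close>, \<open>c\<close>, \<open>v\<close> can be used with every number of states \<open>n\<close>.
\<close>

definition lca_step ::
  "nat \<Rightarrow> (nat \<Rightarrow> int) \<Rightarrow> (nat \<Rightarrow> int ^ 'd) \<Rightarrow> int \<Rightarrow> (int ^ 'd \<Rightarrow> int) \<Rightarrow> int ^ 'd \<Rightarrow> int" where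
  "lca_step m c v n u = (\<lambda>i. (\<Sum>j = 1..m. c j * u (i + v j)) mod n)"

definition single_site_seed :: "int \<Rightarrow> int ^ 'd \<Rightarrow> int" where
  "single_site_seed a = (\<lambda>i. if i = 0 then a else 0)"

definition lca_pattern ::
  "nat \<Rightarrow> (nat \<Rightarrow> int) \<Rightarrow> (nat \<Rightarrow> int ^ 'd) \<Rightarrow> int \<Rightarrow> int \<Rightarrow> nat \<Rightarrow> int ^ 'd \<Rightarrow> int" where
  "lca_pattern m c v n a t = (lca_step m c v n ^^ t) (single_site_seed a)"

definition pattern_values ::
  "nat \<Rightarrow> (nat \<Rightarrow> int) \<Rightarrow> (nat \<Rightarrow> int ^ 'd) \<Rightarrow> int \<Rightarrow> int \<Rightarrow> int set" where
  "pattern_values m c v n a = {b \<in> residues_mod n. \<exists>i t. lca_pattern m c v n a t i = b}"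

text \<open>
  The value sets of patterns need not be subgroups (the identity rule gives \<open>{0, a}\<close>), so an
  isomorphism between subsets \<open>A\<close> of \<open>\<int>/n\<int>\<close> and \<open>B\<close> of \<open>\<int>/n'\<int>\<close> is taken to be a bijection
  that preserves and reflects the addition inherited from the ambient groups, wherever the sum
  remains in the subset. If \<open>A\<close> and \<open>B\<close> are subgroups, these are the group isomorphisms.
\<close>

definition residue_subset_iso :: "int \<Rightarrow> int \<Rightarrow> (int \<Rightarrow> int) \<Rightarrow> int set \<Rightarrow> int set \<Rightarrow> bool" where
  "residue_subset_iso n n' f A B \<longleftrightarrow>
     bij_betw f A B \<and>
     (\<forall>x\<in>A. \<forall>y\<in>A. \<forall>z\<in>A. (x + y) mod n = z \<longleftrightarrow> (f x + f y) mod n' = f z)"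

definition isomorphic_patterns ::
  "nat \<Rightarrow> (nat \<Rightarrow> int) \<Rightarrow> (nat \<Rightarrow> int ^ 'd) \<Rightarrow> int \<Rightarrow> int \<Rightarrow> int \<Rightarrow> int \<Rightarrow> bool" where
  "isomorphic_patterns m c v n a n' a' \<longleftrightarrow>
     (\<exists>f. residue_subset_iso n n' f (pattern_values m c v n a) (pattern_values m c v n' a') \<and>
          (\<forall>i t. f (lca_pattern m c v n a t i) = lca_pattern m c v n' a' t i))"

end

theory Submission
  imports Defs "HOL-Number_Theory.Cong"
begin

text \<open>
  By linearity of the rule, scaling the seed by \<open>k\<close> scales the whole pattern by \<open>k\<close>.
  Since \<open>p\<close> is prime, \<open>k\<close> can be chosen as the unit with \<open>k a = a'\<close> in \<open>\<int>/p\<int>\<close>, and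
  multiplication by a unit is injective and additive.
\<close>

text \<open>Reducing \<open>k * u i\<close> inside each summand leaves the residue of the sum
  unchanged, so \<open>k\<close> factors out.\<close>

lemma lca_step_scale:
  "lca_step m c v n (\<lambda>i. (k * u i) mod n) i = (k * lca_step m c v n u i) mod n"
proof -
  have "[(\<Sum>j = 1..m. c j * ((k * u (i + v j)) mod n)) =
      (\<Sum>j = 1..m. k * (c j * u (i + v j)))] (mod n)"
    by (rule cong_sum) (simp add: cong_def mod_simps mult_ac)
  then show ?thesis
    by (simp add: lca_step_def cong_def sum_distrib_left[symmetric] mod_simps)
qed

lemma lca_pattern_scale:
  "lca_pattern m c v n ((k * a) mod n) t i = (k * lca_pattern m c v n a t i) mod n"
proof (induction t arbitrary: i)
  case 0
  then show ?case by (simp add: lca_pattern_def single_site_seed_def)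
next
  case (Suc t)
  \<comment> \<open>The induction hypothesis at all sites becomes an equality of configurations, to
    which \<open>lca_step_scale\<close> applies.\<close>
  then have "lca_pattern m c v n ((k * a) mod n) t =
      (\<lambda>i. (k * lca_pattern m c v n a t i) mod n)"
    by blast
  then show ?case
    using lca_step_scale[of m c v n k "lca_pattern m c v n a t" i]
    by (simp add: lca_pattern_def)
qed

lemma lca_pattern_in_residues_mod:
  assumes "a \<in> residues_mod n"
  shows "lca_pattern m c v n a t i \<in> residues_mod n"
  using assms
  \<comment> \<open>At time 0 the values are \<open>a\<close> and 0; later ones are reduced by
    \<open>lca_step\<close>, and membership of \<open>a\<close> forces \<open>n > 0\<close>.\<close>
  by (cases t) (auto simp: lca_pattern_def single_site_seed_def lca_step_def residues_mod_def)

lemma pattern_values_eq: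
  assumes "a \<in> residues_mod n"
  shows "pattern_values m c v n a = {lca_pattern m c v n a t i |t i. True}"
  using lca_pattern_in_residues_mod[OF assms] unfolding pattern_values_def by blast

text \<open>A unit \<open>k\<close> can be cancelled modulo \<open>n\<close>, and congruent elements
  of \<open>A\<close> are equal because they are reduced.\<close>

lemma residue_subset_iso_mult:
  assumes "coprime k n" and "A \<subseteq> residues_mod n"
  shows "residue_subset_iso n n (\<lambda>x. (k * x) mod n) A ((\<lambda>x. (k * x) mod n) ` A)"
proof -
  have cancel: "(k * x) mod n = (k * y) mod n \<longleftrightarrow> x mod n = y mod n" for x y
    using cong_mult_lcancel[OF assms(1), of x y] by (simp add: cong_def)
  have reduced: "x mod n = x" if "x \<in> A" for x
    using that assms(2) by (auto simp: residues_mod_def)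
  have "inj_on (\<lambda>x. (k * x) mod n) A"
    by (rule inj_onI) (metis cancel reduced)
  \<comment> \<open>Both directions come from cancelling \<open>k\<close> between
    \<open>k * (x + y)\<close> and \<open>k * z\<close>, with \<open>z mod n = z\<close>.\<close>
  moreover have "(x + y) mod n = z \<longleftrightarrow>
      ((k * x) mod n + (k * y) mod n) mod n = (k * z) mod n" if "z \<in> A" for x y z
    using cancel[of "x + y" z] reduced[OF that] by (simp add: mod_simps distrib_left)
  ultimately show ?thesis
    unfolding residue_subset_iso_def bij_betw_def by blast
qed

text \<open>Works for composite \<open>n\<close> too: only invertibility of \<open>k\<close>
  matters.\<close>

lemma isomorphic_patterns_mult:
  assumes "coprime k n" and "a \<in> residues_mod n" and "(k * a) mod n \<in> residues_mod n"
  shows "isomorphic_patterns m c v n a n ((k * a) mod n)"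
proof -
  let ?f = "\<lambda>x. (k * x) mod n"
  have "pattern_values m c v n (?f a) = ?f ` pattern_values m c v n a"
    unfolding pattern_values_eq[OF assms(2)] pattern_values_eq[OF assms(3)] lca_pattern_scale
    by blast
  moreover have "pattern_values m c v n a \<subseteq> residues_mod n"
    unfolding pattern_values_def by blast
  ultimately have "residue_subset_iso n n ?f (pattern_values m c v n a)
      (pattern_values m c v n (?f a))"
    using residue_subset_iso_mult[OF assms(1)] by metis
  then show ?thesis
    unfolding isomorphic_patterns_def by (intro exI[of _ ?f]) (simp add: lca_pattern_scale)
qed

lemma coprime_residue_prime:
  fixes p :: int
  assumes "prime p" and "a \<in> residues_mod p - {0}"
  shows "coprime a p"
proof -
  have "\<not> p dvd a"
    using assms(2) zdvd_not_zless[of a p] by (auto simp: residues_mod_def)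
  then show ?thesis
    using prime_imp_coprime[OF assms(1)] by (simp add: coprime_commute)
qed

theorem lemma1:
  fixes p a a' :: int and m :: nat and c :: "nat \<Rightarrow> int" and v :: "nat \<Rightarrow> int ^ 'd"
  assumes "prime p"
    and "m \<ge> 1"
    and "a \<in> residues_mod p - {0}"
    and "a' \<in> residues_mod p - {0}"
  shows "isomorphic_patterns m c v p a p a'"
proof -
  have "coprime a p" "coprime a' p"
    using coprime_residue_prime assms(1,3,4) by blast+
  \<comment> \<open>\<open>b\<close> inverts \<open>a\<close> modulo \<open>p\<close>, so
    \<open>a' * b\<close> is a unit taking \<open>a\<close> to \<open>a'\<close>.\<close>
  then obtain b where b: "[a * b = 1] (mod p)"
    using cong_solve_coprime_int by blast
  then have "coprime b p"
    using coprime_iff_invertible_int[of b p] by (metis mult.commute)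
  with \<open>coprime a' p\<close> have k: "coprime (a' * b) p"
    by simp
  have "[a' * (a * b) = a' * 1] (mod p)"
    using b by (rule cong_scalar_left)
  then have "(a' * b * a) mod p = a'"
    using assms(4) by (simp add: cong_def residues_mod_def mult_ac)
  then show ?thesis
    using isomorphic_patterns_mult[OF k, of a] assms(3,4) by simp
qed

end
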